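(* Let $A_1,A_2,B$ be finite-dimensional quantum systems, let $\rho_{A_1}$ be a state on $A_1$, let $\sigma_{A_2B}$ be a state on $A_2B$ (the intermediate) with marginals $\sigma_{A_2}$, $\sigma_B$, and let $U$ be a unitary on $A_1A_2B$. Put $\tau_{A_1A_2B}=U(\rho_{A_1}\otimes\sigma_{A_2B})U^\dagger$, with marginal $\tau_{A_1A_2}=\mathrm{Tr}_B\,\tau_{A_1A_2B}$, and assume the catalysis constraint $\mathrm{Tr}_{A_1A_2}\,\tau_{A_1A_2B}=\sigma_B$. Then the mutual information of the intermediate changes by the entropy production of the state transition: $$I(A_1A_2:B)_\tau-I(A_2:B)_\sigma=S(\tau_{A_1A_2})-S(\rho_{A_1}\otimes\sigma_{A_2}).$$
   Context: $S(\rho)=-\mathrm{Tr}[\rho\log_2\rho]$ is the von Neumann entropy, $S(X)_\omega=S(\omega_X)$ is the entropy of the marginal on $X$, and $I(X:Y)_\omega=S(X)_\omega+S(Y)_\omega-S(XY)_\omega$ is the quantum mutual information. *)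

theory Defs
  imports "HOL-Analysis.Analysis"
begin

text \<open>
  An operator on a finite-dimensional system is given by its matrix in a fixed orthonormal basis
  indexed by a finite type; composite systems are indexed by product types.
\<close>

type_synonym 'n op = "complex ^ 'n ^ 'n"

definition dagger :: "('n::finite) op \<Rightarrow> 'n op" where
  "dagger A = (\<chi> i j. cnj (A $ j $ i))"

definition unitary :: "('n::finite) op \<Rightarrow> bool" where
  "unitary U \<longleftrightarrow> U ** dagger U = mat 1 \<and> dagger U ** U = mat 1"

definition positive_semidefinite :: "('n::finite) op \<Rightarrow> bool" where
  "positive_semidefinite A \<longleftrightarrow>
     dagger A = A \<and> (\<forall>x. 0 \<le> Re (\<Sum>i\<in>UNIV. cnj (x $ i) * (A *v x) $ i))"

definition state :: "('n::finite) op \<Rightarrow> bool" where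
  "state \<rho> \<longleftrightarrow> positive_semidefinite \<rho> \<and> trace \<rho> = 1"

definition tensor :: "('m::finite) op \<Rightarrow> ('n::finite) op \<Rightarrow> ('m \<times> 'n) op"
    (infixr "\<otimes>" 75) where
  "A \<otimes> B = (\<chi> i j. A $ fst i $ fst j * B $ snd i $ snd j)"

definition ptrace_fst :: "('m::finite \<times> 'n::finite) op \<Rightarrow> 'n op" where
  "ptrace_fst A = (\<chi> i j. \<Sum>k\<in>UNIV. A $ (k, i) $ (k, j))"

definition ptrace_snd :: "('m::finite \<times> 'n::finite) op \<Rightarrow> 'm op" where
  "ptrace_snd A = (\<chi> i j. \<Sum>k\<in>UNIV. A $ (i, k) $ (j, k))"

text \<open>
  Product types nest to the right, so an operator on three systems has to be regrouped before it
  can be read as an operator on a pair whose first component is the pair of the first two systems.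
\<close>

definition regroup :: "('l::finite \<times> 'm::finite \<times> 'n::finite) op \<Rightarrow> (('l \<times> 'm) \<times> 'n) op" where
  "regroup A = (\<chi> i j. A $ (fst (fst i), snd (fst i), snd i) $ (fst (fst j), snd (fst j), snd j))"

definition diagonal :: "('n::finite \<Rightarrow> real) \<Rightarrow> 'n op" where
  "diagonal d = (\<chi> i j. if i = j then complex_of_real (d i) else 0)"

text \<open>
  Functional calculus for Hermitian operators. The result does not depend on the choice of
  the diagonalization, which exists precisely for Hermitian \<open>A\<close>; elsewhere the
  value is unspecified.
\<close>

definition hermitian_fun :: "(real \<Rightarrow> real) \<Rightarrow> ('n::finite) op \<Rightarrow> 'n op" where
  "hermitian_fun f A = (THE M. \<exists>V d. unitary V \<and> A = V ** diagonal d ** dagger V \<and>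
                                  M = V ** diagonal (\<lambda>i. f (d i)) ** dagger V)"

text \<open>
  The library's \<open>log 2 0 = 0\<close> agrees with the convention \<open>0 log 0 = 0\<close>: the logarithm is multiplied by
  \<open>\<rho>\<close>, so its value on the kernel of \<open>\<rho>\<close> is irrelevant. The trace is real for a state.
\<close>

definition entropy :: "('n::finite) op \<Rightarrow> real" where
  "entropy \<rho> = - Re (trace (\<rho> ** hermitian_fun (log 2) \<rho>))"

definition mutual_information :: "('m::finite \<times> 'n::finite) op \<Rightarrow> real" where
  "mutual_information \<omega> = entropy (ptrace_snd \<omega>) + entropy (ptrace_fst \<omega>) - entropy \<omega>"

end

theory Submission imports Defs begin

text \<open>
  The entropy is a function of the spectrum, so it is invariant under unitary conjugation, and it
  is additive on tensor products. Hence \<open>S(\<tau>) = S(\<rho>) + S(\<sigma>)\<close> and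
  \<open>S(\<rho> \<otimes> \<sigma>\<^sub>A\<^sub>2) = S(\<rho>) + S(\<sigma>\<^sub>A\<^sub>2)\<close>, while the catalysis constraint makes the terms
  \<open>S(B)\<close> of the two mutual informations cancel. To evaluate the functional calculus one needs the
  spectral theorem for Hermitian matrices: an eigenvector orthogonal to given ones maximizes the
  quadratic form on the unit sphere of their orthogonal complement.
\<close>

section \<open>The spectral theorem\<close>

text \<open>The library's \<open>\<bullet>\<close> on complex vectors is the real inner product,
  that is, the real part of this form. Orthonormality over the complex numbers needs the form
  itself, conjugate-linear in the first argument.\<close>

definition cinner :: "complex ^ 'n \<Rightarrow> complex ^ ('n::finite) \<Rightarrow> complex" where
  "cinner x y = (\<Sum>i\<in>UNIV. cnj (x $ i) * y $ i)"

lemma Re_cinner: "Re (cinner x y) = x \<bullet> y"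
  by (simp add: cinner_def inner_vec_def inner_complex_def)

lemma cinner_add_right: "cinner x (y + z) = cinner x y + cinner x z"
  and cinner_diff_right: "cinner x (y - z) = cinner x y - cinner x z"
  and cinner_scale_right: "cinner x (c *s y) = c * cinner x y"
  and cinner_scaleR_right: "cinner x (r *\<^sub>R y) = of_real r * cinner x y"
  and cinner_zero_right: "cinner x 0 = 0"
  by (simp_all add: cinner_def algebra_simps sum.distrib sum_subtractf sum_distrib_left
      scaleR_conv_of_real[where 'a = complex])

lemma cinner_sum_right: "cinner x (sum f S) = (\<Sum>s\<in>S. cinner x (f s))"
  by (induction S rule: infinite_finite_induct) (simp_all add: cinner_add_right cinner_zero_right)

lemma cinner_commute: "cinner y x = cnj (cinner x y)"
  by (simp add: cinner_def mult.commute)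

lemma cinner_self: "cinner x x = of_real (x \<bullet> x)"
proof (rule complex_eqI)
  have "cnj (cinner x x) = cinner x x"
    by (simp flip: cinner_commute)
  then have "Im (cinner x x) = 0"
    by (simp add: complex_eq_iff)
  then show "Im (cinner x x) = Im (of_real (x \<bullet> x))"
    by simp
qed (simp add: Re_cinner)

lemma cinner_hermitian:
  assumes "dagger A = A"
  shows "cinner x (A *v y) = cinner (A *v x) y"
proof -
  have A: "cnj (A $ j $ i) = A $ i $ j" for i j
    using arg_cong[OF assms, of "\<lambda>M. M $ i $ j"] by (simp add: dagger_def)
  have "cinner x (A *v y) = (\<Sum>i\<in>UNIV. \<Sum>j\<in>UNIV. cnj (x $ i) * (A $ i $ j * y $ j))"
    by (simp add: cinner_def matrix_vector_mult_def sum_distrib_left)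
  also have "\<dots> = (\<Sum>j\<in>UNIV. \<Sum>i\<in>UNIV. cnj (x $ i) * (A $ i $ j * y $ j))"
    by (rule sum.swap)
  also have "\<dots> = cinner (A *v x) y"
    by (simp add: cinner_def matrix_vector_mult_def sum_distrib_left sum_distrib_right A mult_ac)
  finally show ?thesis .
qed

section \<open>Eigenvectors by maximizing the quadratic form\<close>

lemma complex_matrix_vector_mult_scaleR:
  fixes A :: "complex ^ 'n ^ 'm"
  shows "A *v (r *\<^sub>R x) = r *\<^sub>R (A *v x)"
  by (rule linear_scale) (rule matrix_vector_mul_linear)

text \<open>The Rayleigh quotient attains its maximum \<open>l\<close> on the compact unit sphere of
  \<open>W\<close>, and the first-order condition at a maximizer is the eigenvalue equation.\<close>

lemma hermitian_eigenvector_in_subspace: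
  fixes A :: "('n::finite) op"
  assumes A: "dagger A = A"
    and W: "subspace W" and inv: "\<And>x. x \<in> W \<Longrightarrow> A *v x \<in> W"
    and nz: "w \<in> W" "w \<noteq> 0"
  obtains x l where "x \<in> W" "x \<bullet> x = 1" "A *v x = l *\<^sub>R x"
proof -
  have sym: "x \<bullet> (A *v y) = (A *v x) \<bullet> y" for x y
    by (metis A Re_cinner cinner_hermitian)
  define K where "K = W \<inter> sphere 0 1"
  have "compact K"
    unfolding K_def by (intro closed_Int_compact closed_subspace W compact_sphere)
  moreover have "(1 / norm w) *\<^sub>R w \<in> K"
    using nz W by (simp add: K_def subspace_scale)
  then have "K \<noteq> {}" by blast
  moreover have "continuous_on K (\<lambda>x. x \<bullet> (A *v x))"
    by (intro continuous_intros linear_continuous_on matrix_vector_mul_bounded_linear)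
  ultimately obtain x where x: "x \<in> K" and max: "\<And>y. y \<in> K \<Longrightarrow> y \<bullet> (A *v y) \<le> x \<bullet> (A *v x)"
    using continuous_attains_sup by metis
  define l where "l = x \<bullet> (A *v x)"
  have xW: "x \<in> W" and xx: "x \<bullet> x = 1"
    using x by (simp_all add: K_def norm_eq_1)
  have le: "z \<bullet> (A *v z) \<le> l * (z \<bullet> z)" if "z \<in> W" for z
  proof (cases "z = 0")
    case False
    have "(1 / norm z) *\<^sub>R z \<in> K"
      using False that W by (simp add: K_def subspace_scale)
    from max[OF this] have "(z \<bullet> (A *v z)) / (norm z)\<^sup>2 \<le> l"
      by (simp add: l_def complex_matrix_vector_mult_scaleR power2_eq_square)
    then show ?thesis
      using False by (simp add: power2_norm_eq_inner pos_divide_le_eq)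
  qed simp
  \<comment> \<open>The part of \<open>A *v x\<close> orthogonal to \<open>x\<close>, which lies in
    \<open>W\<close> by invariance. It remains to show that it vanishes.\<close>
  define y where "y = A *v x - l *\<^sub>R x"
  have yW: "y \<in> W"
    unfolding y_def by (intro subspace_diff W inv subspace_scale xW)
  have xy: "x \<bullet> y = 0"
    by (simp add: y_def inner_diff_right xx flip: l_def)
  have Ax: "A *v x = y + l *\<^sub>R x"
    by (simp add: y_def)
  define a where "a = y \<bullet> y"
  define c where "c = y \<bullet> (A *v y) - l * a"
  \<comment> \<open>Moving from \<open>x\<close> in the direction \<open>y\<close> cannot raise the
    Rayleigh quotient above \<open>l\<close>. The linear coefficient in \<open>t\<close> is twice
    the squared norm of \<open>y\<close>.\<close>
  have quad: "2 * t * a + t * t * c \<le> 0" for t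
  proof -
    have "(x + t *\<^sub>R y) \<bullet> (A *v (x + t *\<^sub>R y)) = l + 2 * t * a + t * t * (y \<bullet> (A *v y))"
      using xy by (simp add: matrix_vector_right_distrib complex_matrix_vector_mult_scaleR inner_add_left
          inner_add_right sym[of x y] Ax xx inner_commute[of y x] algebra_simps flip: a_def)
    moreover have "(x + t *\<^sub>R y) \<bullet> (x + t *\<^sub>R y) = 1 + t * t * a"
      using xy by (simp add: inner_add_left inner_add_right xx inner_commute[of y x] flip: a_def)
    ultimately show ?thesis
      using le[OF subspace_add[OF W xW subspace_scale[OF W yW, of t]]]
      by (simp add: c_def algebra_simps)
  qed
  have "a = 0"
  proof (rule ccontr)
    assume "a \<noteq> 0"
    then have a: "a > 0" by (simp add: a_def)
    \<comment> \<open>This \<open>t\<close> is small enough that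
      \<open>t * \<bar>c\<bar> < a\<close>, so the linear term dominates; the summand 1 makes this
      strict and covers \<open>c = 0\<close>.\<close>
    define t where "t = a / (\<bar>c\<bar> + 1)"
    have t: "t > 0" using a by (simp add: t_def add_nonneg_pos)
    have "t * (2 * a + t * c) \<le> 0"
      using quad[of t] by (simp add: algebra_simps)
    then have "2 * a + t * c \<le> 0"
      using t by (simp add: mult_le_0_iff)
    moreover have "t * \<bar>c\<bar> < a"
      using a by (simp add: t_def field_simps)
    moreover have "t * (- c) \<le> t * \<bar>c\<bar>"
      using t by (intro mult_left_mono) auto
    ultimately show False using a by simp
  qed
  then have "A *v x = l *\<^sub>R x"
    by (simp add: a_def y_def)
  then show thesis using that xW xx by blast
qed

definition orthonormal_eigenvectors :: "('n::finite) op \<Rightarrow> (complex ^ 'n) set \<Rightarrow> bool" where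
  "orthonormal_eigenvectors A S \<longleftrightarrow> finite S \<and>
     (\<forall>u\<in>S. \<forall>v\<in>S. cinner u v = (if u = v then 1 else 0)) \<and> (\<forall>v\<in>S. \<exists>l::real. A *v v = l *\<^sub>R v)"

text \<open>Complex orthonormality implies real orthogonality, hence real independence. The bound is
  the real dimension, twice the complex one; it serves only to make a set of maximal size
  exist.\<close>

lemma card_orthonormal_eigenvectors_le:
  fixes S :: "(complex ^ ('n::finite)) set"
  assumes "orthonormal_eigenvectors A S"
  shows "card S \<le> DIM(complex ^ 'n)"
proof -
  have *: "u \<bullet> v = (if u = v then 1 else 0)" if "u \<in> S" "v \<in> S" for u v
    using assms that by (simp add: orthonormal_eigenvectors_def flip: Re_cinner)
  have "pairwise orthogonal S"
    by (simp add: pairwise_def orthogonal_def *)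
  moreover have "0 \<notin> S"
    using *[of 0 0] by auto
  ultimately show ?thesis
    using pairwise_orthogonal_independent independent_bound by blast
qed

text \<open>The orthogonal complement of a set of eigenvectors of a Hermitian matrix is invariant
  under it, so a nonzero complement contains a further unit eigenvector.\<close>

lemma orthonormal_eigenvectors_insert:
  assumes A: "dagger A = A" and S: "orthonormal_eigenvectors A S"
    and w: "w \<noteq> 0" "\<And>v. v \<in> S \<Longrightarrow> cinner v w = 0"
  obtains x where "x \<notin> S" "orthonormal_eigenvectors A (insert x S)"
proof -
  define W where "W = {x. \<forall>v\<in>S. cinner v x = 0}"
  have "subspace W"
    by (auto simp: W_def subspace_def cinner_zero_right cinner_add_right cinner_scaleR_right)
  moreover have "A *v x \<in> W" if "x \<in> W" for x
    unfolding W_def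
  proof (intro CollectI ballI)
    fix v assume v: "v \<in> S"
    then obtain l :: real where "A *v v = l *\<^sub>R v"
      using S unfolding orthonormal_eigenvectors_def by blast
    then have "cinner (A *v v) x = cnj (cinner x (l *\<^sub>R v))"
      by (metis cinner_commute)
    also have "\<dots> = l * cinner v x"
      by (simp add: cinner_scaleR_right flip: cinner_commute)
    also have "\<dots> = 0"
      using that v by (simp add: W_def)
    finally show "cinner v (A *v x) = 0"
      by (simp add: cinner_hermitian[OF A])
  qed
  moreover have "w \<in> W"
    using w by (simp add: W_def)
  ultimately obtain x and l :: real where x: "x \<in> W" "x \<bullet> x = 1" "A *v x = l *\<^sub>R x"
    using hermitian_eigenvector_in_subspace[OF A] w(1) by metis
  have vx: "cinner v x = 0" "cinner x v = 0" if "v \<in> S" for v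
    using x(1) that cinner_commute[of x v] by (simp_all add: W_def)
  have xx: "cinner x x = 1"
    by (simp add: cinner_self x)
  have "x \<notin> S"
    using vx xx by force
  then show thesis
    using that S x(3) vx xx unfolding orthonormal_eigenvectors_def by (smt (verit) finite_insert insert_iff)
qed

text \<open>A set of maximal size spans: otherwise some vector minus its projection would be nonzero
  and orthogonal to the set, which could then be enlarged.\<close>

lemma orthonormal_eigenbasis_exists:
  fixes A :: "('n::finite) op"
  assumes A: "dagger A = A"
  shows "\<exists>S. orthonormal_eigenvectors A S \<and> (\<forall>x. x = (\<Sum>v\<in>S. cinner v x *s v))"
proof -
  have "orthonormal_eigenvectors A {}"
    by (simp add: orthonormal_eigenvectors_def)
  then obtain S where S: "orthonormal_eigenvectors A S"
    and max: "\<And>T. orthonormal_eigenvectors A T \<Longrightarrow> card T \<le> card S"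
    using ex_has_greatest_nat[of "orthonormal_eigenvectors A" "{}" card "DIM(complex^'n) + 1"]
      card_orthonormal_eigenvectors_le[of A] by (auto simp: less_Suc_eq_le)
  have "x = (\<Sum>v\<in>S. cinner v x *s v)" for x
  proof (rule ccontr)
    define w where "w = x - (\<Sum>v\<in>S. cinner v x *s v)"
    assume "x \<noteq> (\<Sum>v\<in>S. cinner v x *s v)"
    then have "w \<noteq> 0" by (simp add: w_def)
    moreover have "cinner u w = 0" if u: "u \<in> S" for u
    proof -
      have "(\<Sum>v\<in>S. cinner v x * cinner u v) = (\<Sum>v\<in>S. if u = v then cinner v x else 0)"
        by (rule sum.cong) (use S u in \<open>auto simp: orthonormal_eigenvectors_def\<close>)
      also have "\<dots> = cinner u x"
        using S u by (simp add: orthonormal_eigenvectors_def)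
      finally show ?thesis
        by (simp add: w_def cinner_diff_right cinner_sum_right cinner_scale_right)
    qed
    ultimately obtain y where "y \<notin> S" "orthonormal_eigenvectors A (insert y S)"
      using orthonormal_eigenvectors_insert[OF A S] by metis
    with max[of "insert y S"] S show False
      by (simp add: orthonormal_eigenvectors_def)
  qed
  then show ?thesis using S by blast
qed

text \<open>The condition under the \<open>THE\<close> of \<open>hermitian_fun\<close>: the columns
  of \<open>V\<close> are eigenvectors and \<open>d\<close> lists their eigenvalues, with
  multiplicity.\<close>

definition diagonalizes :: "('n::finite) op \<Rightarrow> ('n \<Rightarrow> real) \<Rightarrow> 'n op \<Rightarrow> bool" where
  "diagonalizes V d A \<longleftrightarrow> unitary V \<and> A = V ** diagonal d ** dagger V"

lemma matrix_mult_diagonal: "(A ** diagonal d) $ i $ j = A $ i $ j * of_real (d j)"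
proof -
  have "(A ** diagonal d) $ i $ j = (\<Sum>k\<in>UNIV. if k = j then A $ i $ k * of_real (d k) else 0)"
    by (simp add: matrix_matrix_mult_def diagonal_def if_distrib cong: if_cong)
  then show ?thesis by simp
qed

lemma diagonal_mult_matrix: "(diagonal d ** A) $ i $ j = of_real (d i) * A $ i $ j"
proof -
  have "(diagonal d ** A) $ i $ j = (\<Sum>k\<in>UNIV. if i = k then of_real (d i) * A $ k $ j else 0)"
    unfolding matrix_matrix_mult_def diagonal_def by (simp only: vec_lambda_beta) (rule sum.cong, auto)
  then show ?thesis by simp
qed

theorem hermitian_diagonalizable:
  fixes A :: "('n::finite) op"
  assumes A: "dagger A = A"
  obtains V d where "diagonalizes V d A"
proof -
  obtain S where S: "orthonormal_eigenvectors A S" and span: "\<And>x. x = (\<Sum>v\<in>S. cinner v x *s v)"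
    using orthonormal_eigenbasis_exists[OF A] by blast
  have fin: "finite S" using S by (simp add: orthonormal_eigenvectors_def)
  \<comment> \<open>The resolution of the identity, read off entrywise by expanding the standard
    basis vectors in the eigenbasis.\<close>
  have complete: "(\<Sum>v\<in>S. v $ i * cnj (v $ j)) = (if i = j then 1 else 0)" for i j
  proof -
    have "cinner v (axis j 1) = cnj (v $ j)" for v :: "complex ^ 'n"
    proof -
      have "cinner v (axis j 1) = (\<Sum>i\<in>UNIV. if i = j then cnj (v $ j) else 0)"
        unfolding cinner_def axis_def by (intro sum.cong) auto
      then show ?thesis by simp
    qed
    then have "axis j 1 = (\<Sum>v\<in>S. cnj (v $ j) *s v)"
      using span[of "axis j 1"] by simp
    then have "axis j 1 $ i = (\<Sum>v\<in>S. cnj (v $ j) *s v) $ i" by simp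
    then show ?thesis by (simp add: axis_def mult.commute)
  qed
  \<comment> \<open>Taking the trace of the resolution of the identity gives the exact size of
    \<open>S\<close>, so that its elements can be indexed by the type \<open>'n\<close> and become
    the columns of \<open>V\<close>.\<close>
  have "of_nat (card S) = (\<Sum>v\<in>S. cinner v v)"
    using S by (simp add: orthonormal_eigenvectors_def)
  also have "\<dots> = (\<Sum>i\<in>UNIV. \<Sum>v\<in>S. v $ i * cnj (v $ i))"
    unfolding cinner_def by (subst sum.swap) (simp add: mult.commute)
  also have "\<dots> = of_nat CARD('n)"
    by (simp add: complete)
  finally have "card S = CARD('n)"
    using of_nat_eq_iff by blast
  then obtain f where f: "bij_betw f (UNIV :: 'n set) S"
    using finite_same_card_bij[OF _ fin] by (metis finite_class.finite_UNIV)
  have fS: "f j \<in> S" for j using f by (auto simp: bij_betw_def)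
  have "\<forall>j. \<exists>l::real. A *v f j = l *\<^sub>R f j"
    using S fS by (auto simp: orthonormal_eigenvectors_def)
  then obtain d :: "'n \<Rightarrow> real" where d: "\<And>j. A *v f j = d j *\<^sub>R f j" by metis
  define V :: "'n op" where "V = (\<chi> i j. f j $ i)"
  \<comment> \<open>Completeness of the eigenbasis gives this identity, and its orthonormality gives
    the next one.\<close>
  have 1: "V ** dagger V = mat 1"
  proof -
    have "(\<Sum>k\<in>UNIV. f k $ i * cnj (f k $ j)) = (if i = j then 1 else 0)" for i j
      using sum.reindex_bij_betw[OF f, of "\<lambda>v. v $ i * cnj (v $ j)"] complete by simp
    then show ?thesis
      by (simp add: V_def dagger_def matrix_matrix_mult_def mat_def vec_eq_iff)
  qed
  have 2: "dagger V ** V = mat 1"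
  proof -
    have "cinner (f i) (f j) = (if i = j then 1 else 0)" for i j
      using S fS f by (auto simp: orthonormal_eigenvectors_def bij_betw_def inj_on_def)
    then show ?thesis
      by (simp add: V_def dagger_def matrix_matrix_mult_def mat_def vec_eq_iff cinner_def)
  qed
  have "(A ** V) $ i $ j = (V ** diagonal d) $ i $ j" for i j
  proof -
    have "(A ** V) $ i $ j = (A *v f j) $ i"
      by (simp add: V_def matrix_matrix_mult_def matrix_vector_mult_def)
    then show ?thesis
      by (simp add: d matrix_mult_diagonal V_def scaleR_conv_of_real[where 'a = complex] mult.commute)
  qed
  then have "A ** V = V ** diagonal d"
    by (simp add: vec_eq_iff)
  then have "A = V ** diagonal d ** dagger V"
    by (metis 1 matrix_mul_assoc matrix_mul_rid)
  then show thesis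
    using that 1 2 by (simp add: diagonalizes_def unitary_def)
qed

section \<open>Entropy in terms of eigenvalues\<close>

text \<open>
  With \<open>Q = W\<^sup>\<dagger>V\<close>, the hypothesis says \<open>Q\<^sub>i\<^sub>j d\<^sub>j = e\<^sub>i Q\<^sub>i\<^sub>j\<close>, so \<open>d\<^sub>j = e\<^sub>i\<close> wherever \<open>Q\<^sub>i\<^sub>j \<noteq> 0\<close>.
\<close>

lemma diagonal_conjugation_cong:
  assumes V: "unitary V" and W: "unitary W"
    and eq: "V ** diagonal d ** dagger V = W ** diagonal e ** dagger W"
  shows "V ** diagonal (\<lambda>i. f (d i)) ** dagger V = W ** diagonal (\<lambda>i. f (e i)) ** dagger W"
proof -
  have V1: "V ** dagger V = mat 1" "dagger V ** V = mat 1"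
    and W1: "W ** dagger W = mat 1" "dagger W ** W = mat 1"
    using V W by (simp_all add: unitary_def)
  define Q where "Q = dagger W ** V"
  have "Q ** diagonal d = dagger W ** (V ** diagonal d ** dagger V) ** V"
    by (metis Q_def V1(2) matrix_mul_assoc matrix_mul_rid)
  also have "\<dots> = diagonal e ** Q"
    by (metis eq Q_def W1(2) matrix_mul_assoc matrix_mul_lid)
  finally have "Q $ i $ j * of_real (d j) = of_real (e i) * Q $ i $ j" for i j
    by (metis matrix_mult_diagonal diagonal_mult_matrix)
  then have "Q $ i $ j = 0 \<or> d j = e i" for i j
    by (metis mult.commute mult_cancel_left of_real_eq_iff)
  then have "(Q ** diagonal (\<lambda>i. f (d i))) $ i $ j = (diagonal (\<lambda>i. f (e i)) ** Q) $ i $ j" for i j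
    unfolding matrix_mult_diagonal diagonal_mult_matrix by (metis mult.commute mult_zero_left)
  then have Q: "Q ** diagonal (\<lambda>i. f (d i)) = diagonal (\<lambda>i. f (e i)) ** Q"
    by (simp add: vec_eq_iff)
  have "V ** diagonal (\<lambda>i. f (d i)) ** dagger V = W ** (Q ** diagonal (\<lambda>i. f (d i))) ** dagger V"
    by (metis Q_def W1(1) matrix_mul_assoc matrix_mul_lid)
  also have "\<dots> = W ** diagonal (\<lambda>i. f (e i)) ** dagger W"
    by (metis Q Q_def V1(1) matrix_mul_assoc matrix_mul_rid)
  finally show ?thesis .
qed

text \<open>Any two diagonalizations yield the same matrix by
  \<open>diagonal_conjugation_cong\<close>, so the definite description may be evaluated with any
  one of them.\<close>

lemma hermitian_fun_diagonalizes:
  assumes "diagonalizes V d A"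
  shows "hermitian_fun f A = V ** diagonal (\<lambda>i. f (d i)) ** dagger V"
  unfolding hermitian_fun_def
  using assms by (intro the_equality) (auto simp: diagonalizes_def intro: diagonal_conjugation_cong)

lemma trace_diagonalizes:
  assumes "diagonalizes V d A"
  shows "trace A = of_real (\<Sum>i\<in>UNIV. d i)"
proof -
  have "trace A = trace (dagger V ** V ** diagonal d)"
    using assms by (metis diagonalizes_def matrix_mul_assoc trace_mul_sym)
  then show ?thesis
    using assms by (simp add: diagonalizes_def unitary_def) (simp add: trace_def diagonal_def)
qed

text \<open>The operator and its logarithm are diagonal in the same basis, so their product is too,
  and its trace is the sum of its eigenvalues.\<close>

lemma entropy_diagonalizes:
  assumes "diagonalizes V d A"
  shows "entropy A = - (\<Sum>i\<in>UNIV. d i * log 2 (d i))"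
proof -
  have V: "unitary V" "dagger V ** V = mat 1" and A: "A = V ** diagonal d ** dagger V"
    using assms by (simp_all add: diagonalizes_def unitary_def)
  have "diagonal d ** diagonal (\<lambda>i. log 2 (d i)) = diagonal (\<lambda>i. d i * log 2 (d i))"
    by (simp add: vec_eq_iff diagonal_mult_matrix) (simp add: diagonal_def)
  moreover have "A ** hermitian_fun (log 2) A
      = V ** diagonal d ** (dagger V ** V) ** diagonal (\<lambda>i. log 2 (d i)) ** dagger V"
    unfolding hermitian_fun_diagonalizes[OF assms] by (subst A) (simp add: matrix_mul_assoc)
  ultimately have "A ** hermitian_fun (log 2) A = V ** diagonal (\<lambda>i. d i * log 2 (d i)) ** dagger V"
    by (simp add: V(2) flip: matrix_mul_assoc)
  then have "diagonalizes V (\<lambda>i. d i * log 2 (d i)) (A ** hermitian_fun (log 2) A)"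
    using V by (simp add: diagonalizes_def)
  from trace_diagonalizes[OF this] show ?thesis
    by (simp add: entropy_def)
qed

section \<open>Unitary invariance of the entropy\<close>

lemma dagger_mult: "dagger (A ** B) = dagger B ** dagger A"
  by (simp add: dagger_def matrix_matrix_mult_def vec_eq_iff mult.commute)

lemma diagonalizes_conjugate:
  assumes "unitary U" "diagonalizes V d A"
  shows "diagonalizes (U ** V) d (U ** A ** dagger U)"
proof -
  have "U ** V ** dagger (U ** V) = U ** (V ** dagger V) ** dagger U"
    and "dagger (U ** V) ** (U ** V) = dagger V ** (dagger U ** U) ** V"
    and "U ** (V ** diagonal d ** dagger V) ** dagger U = U ** V ** diagonal d ** dagger (U ** V)"
    by (simp_all add: dagger_mult matrix_mul_assoc)
  then show ?thesis
    using assms by (simp add: diagonalizes_def unitary_def)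
qed

lemma entropy_unitary_conjugate:
  assumes "unitary U" "dagger A = A"
  shows "entropy (U ** A ** dagger U) = entropy A"
  by (metis assms diagonalizes_conjugate entropy_diagonalizes hermitian_diagonalizable)

section \<open>Composite systems\<close>

lemma tensor_mult: "(A \<otimes> B) ** (C \<otimes> D) = (A ** C) \<otimes> (B ** D)"
  by (simp add: vec_eq_iff tensor_def matrix_matrix_mult_def sum_product sum.cartesian_product
      case_prod_beta mult_ac flip: UNIV_Times_UNIV)

lemma dagger_tensor: "dagger (A \<otimes> B) = dagger A \<otimes> dagger B"
  by (simp add: vec_eq_iff tensor_def dagger_def)

lemma tensor_mat_1: "mat 1 \<otimes> mat 1 = mat 1"
  by (auto simp: vec_eq_iff tensor_def mat_def prod_eq_iff)

lemma tensor_diagonal: "diagonal d \<otimes> diagonal e = diagonal (\<lambda>(i, j). d i * e j)"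
  by (auto simp: vec_eq_iff tensor_def diagonal_def)

lemma diagonalizes_tensor:
  assumes "diagonalizes V d A" "diagonalizes W e B"
  shows "diagonalizes (V \<otimes> W) (\<lambda>(i, j). d i * e j) (A \<otimes> B)"
  using assms
  by (simp add: diagonalizes_def unitary_def dagger_tensor tensor_mult tensor_mat_1 flip: tensor_diagonal)

text \<open>
  The library's convention \<open>ln (- x) = ln x\<close> makes the logarithm additive on all nonzero reals,
  so the signs of the eigenvalues need not be tracked.
\<close>

lemma entropy_tensor:
  assumes "dagger A = A" "trace A = 1" "dagger B = B" "trace B = 1"
  shows "entropy (A \<otimes> B) = entropy A + entropy B"
proof -
  obtain V d where A: "diagonalizes V d A" using hermitian_diagonalizable[OF assms(1)] .
  obtain W e where B: "diagonalizes W e B" using hermitian_diagonalizable[OF assms(3)] .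
  have d: "(\<Sum>i\<in>UNIV. d i) = 1" and e: "(\<Sum>j\<in>UNIV. e j) = 1"
    using trace_diagonalizes[OF A] trace_diagonalizes[OF B] assms by (metis of_real_eq_1_iff)+
  have "(\<Sum>p\<in>UNIV. (case p of (i, j) \<Rightarrow> d i * e j) * log 2 (case p of (i, j) \<Rightarrow> d i * e j))
      = (\<Sum>i\<in>UNIV. \<Sum>j\<in>UNIV. d i * e j * log 2 (d i * e j))"
    by (simp add: sum.cartesian_product case_prod_beta flip: UNIV_Times_UNIV)
  \<comment> \<open>If \<open>d i\<close> or \<open>e j\<close> is zero, every term carries that
    zero factor, whatever the logarithm returns.\<close>
  also have "\<dots> = (\<Sum>i\<in>UNIV. \<Sum>j\<in>UNIV. d i * log 2 (d i) * e j + d i * (e j * log 2 (e j)))"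
    by (intro sum.cong) (auto simp: log_mult algebra_simps)
  \<comment> \<open>Each factor not under a logarithm sums to 1, because both traces are 1.\<close>
  also have "\<dots> = (\<Sum>i\<in>UNIV. d i * log 2 (d i)) + (\<Sum>j\<in>UNIV. e j * log 2 (e j))"
    by (simp add: sum.distrib d e flip: sum_distrib_left sum_distrib_right)
  finally show ?thesis
    using entropy_diagonalizes[OF diagonalizes_tensor[OF A B]] entropy_diagonalizes[OF A]
      entropy_diagonalizes[OF B] by simp
qed

section \<open>Partial traces and regrouping\<close>

lemma dagger_ptrace_snd: "dagger (ptrace_snd A) = ptrace_snd (dagger A)"
  by (simp add: vec_eq_iff dagger_def ptrace_snd_def)

lemma trace_ptrace_snd: "trace (ptrace_snd A) = trace A"
  by (simp add: trace_def ptrace_snd_def sum.cartesian_product case_prod_beta flip: UNIV_Times_UNIV)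

text \<open>Regrouping is a relabelling of the basis along this bijection; sums over intermediate
  indices and over eigenvalues are transported through it.\<close>

lemma bij_regroup: "bij (\<lambda>p. (fst (fst p), snd (fst p), snd p))"
  by (rule bij_betw_byWitness[where f' = "\<lambda>q. ((fst q, fst (snd q)), snd (snd q))"]) auto

lemma regroup_mult: "regroup (A ** B) = regroup A ** regroup B"
  by (simp add: vec_eq_iff regroup_def matrix_matrix_mult_def)
    (subst sum.reindex_bij_betw[OF bij_regroup, symmetric], simp)

lemma dagger_regroup: "dagger (regroup A) = regroup (dagger A)"
  by (simp add: vec_eq_iff dagger_def regroup_def)

lemma regroup_mat_1: "regroup (mat 1) = mat 1"
  by (auto simp: vec_eq_iff regroup_def mat_def prod_eq_iff)

lemma regroup_diagonal: "regroup (diagonal d) = diagonal (\<lambda>p. d (fst (fst p), snd (fst p), snd p))"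
  by (auto simp: vec_eq_iff regroup_def diagonal_def)

lemma diagonalizes_regroup:
  assumes "diagonalizes V d A"
  shows "diagonalizes (regroup V) (\<lambda>p. d (fst (fst p), snd (fst p), snd p)) (regroup A)"
  using assms
  by (simp add: diagonalizes_def unitary_def dagger_regroup regroup_mat_1 flip: regroup_mult regroup_diagonal)

text \<open>Regrouping a diagonalization gives a diagonalization whose eigenvalues are merely
  reindexed.\<close>

lemma entropy_regroup:
  assumes "dagger A = A"
  shows "entropy (regroup A) = entropy A"
proof -
  obtain V d where A: "diagonalizes V d A" using hermitian_diagonalizable[OF assms] .
  show ?thesis
    unfolding entropy_diagonalizes[OF A] entropy_diagonalizes[OF diagonalizes_regroup[OF A]]
    using sum.reindex_bij_betw[OF bij_regroup, of "\<lambda>i. d i * log 2 (d i)"] by simp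
qed

theorem theorem5:
  fixes \<rho> :: "('a1::finite) op"
    and \<sigma> :: "('a2::finite \<times> 'b::finite) op"
    and U \<tau> :: "('a1 \<times> 'a2 \<times> 'b) op"
  assumes "state \<rho>"
    and "state \<sigma>"
    and "unitary U"
    and "\<tau> = U ** (\<rho> \<otimes> \<sigma>) ** dagger U"
    and "ptrace_fst (regroup \<tau>) = ptrace_fst \<sigma>"
  shows "mutual_information (regroup \<tau>) - mutual_information \<sigma>
       = entropy (ptrace_snd (regroup \<tau>)) - entropy (\<rho> \<otimes> ptrace_snd \<sigma>)"
proof -
  have \<rho>: "dagger \<rho> = \<rho>" "trace \<rho> = 1" and \<sigma>: "dagger \<sigma> = \<sigma>" "trace \<sigma> = 1"
    using assms by (auto simp: state_def positive_semidefinite_def)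
  have \<rho>\<sigma>: "dagger (\<rho> \<otimes> \<sigma>) = \<rho> \<otimes> \<sigma>"
    by (simp add: dagger_tensor \<rho> \<sigma>)
  have "dagger (dagger U) = U"
    by (simp add: vec_eq_iff dagger_def)
  then have "dagger \<tau> = \<tau>"
    by (simp add: assms(4) dagger_mult \<rho>\<sigma> matrix_mul_assoc)
  \<comment> \<open>Regrouping and conjugation by \<open>U\<close> both preserve the spectrum, which
    leaves the entropy of a product.\<close>
  then have "entropy (regroup \<tau>) = entropy \<rho> + entropy \<sigma>"
    using entropy_regroup entropy_unitary_conjugate[OF assms(3) \<rho>\<sigma>] entropy_tensor[OF \<rho> \<sigma>] assms(4)
    by metis
  moreover have "entropy (\<rho> \<otimes> ptrace_snd \<sigma>) = entropy \<rho> + entropy (ptrace_snd \<sigma>)"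
    by (rule entropy_tensor) (simp_all add: \<rho> \<sigma> dagger_ptrace_snd trace_ptrace_snd)
  \<comment> \<open>The entropies of \<open>B\<close> agree by the catalysis constraint and those of
    \<open>\<sigma>\<close> cancel; the remaining \<open>entropy \<rho>\<close> and
    \<open>entropy (ptrace_snd \<sigma>)\<close> form the subtracted entropy of the product.\<close>
  ultimately show ?thesis
    by (simp add: mutual_information_def assms(5))
qed

end
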